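(* Let $T>0$, $r>0$, $\rho\ge 0$, $\sigma>0$, $c>0$, and let $\alpha:[0,T]\to[0,\infty)$ be a time profile satisfying the standing assumptions of the context. Let $\nu$ be a Lévy measure on $\mathbb{R}_0=\mathbb{R}\setminus\{0\}$ with finite large-jump intensity $\lambda:=\nu(\{|z|>1\})<\infty$, and let $\gamma$ be an admissible jump amplitude with constant $L_\gamma>0$ such that $$r+\rho=\sqrt{\lambda}\,L_\gamma .$$ In addition, assume the following no-crossing condition on the negative tail: there exist constants $\Delta\in(0,1)$ and $R_0>0$ such that, for every $g\le -R_0$ and for $\nu$-a.e. $z$ with $|z|>1$, $$g+\gamma(g,z)\le-\Delta|g|.$$ Then there exists a nonnegative continuous (global, i.e. on all of $\mathbb{R}\times[0,T]$) viscosity supersolution $\tilde u$ of the obstacle problem $$\min\left(-\mathcal{L}^{\nu}u(g,t),\ u(g,t)-u(-g,t)-\psi(g,t)\right)=0\ \text{ on }\mathbb{R}\times[0,T),\qquad u(g,T)=0\ \text{ for } g\in\mathbb{R},$$ with at most linear growth in the spatial variable; more precisely, there exists a constant $C>0$ such that $$0\le\tilde u(g,t)\le C(1+|g|),\qquad (g,t)\in\mathbb{R}\times[0,T].$$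
   Context: Standing assumptions on the time profile: $\alpha\in C^1([0,T])$, $\alpha(t)\ge 0$ for all $t\in[0,T]$, $\alpha\not\equiv 0$, $\alpha(T)=0$, and $\alpha'(t)\le 0$ for all $t$. The payoff is $\psi(g,t):=g\,\alpha(t)-c$. Lévy measure: a Borel measure $\nu$ on $\mathbb{R}_0=\mathbb{R}\setminus\{0\}$ with $\int_{\mathbb{R}_0}\min(1,z^2)\,\nu(dz)<\infty$. Admissible jump amplitude: $\gamma:\mathbb{R}\times\mathbb{R}_0\to\mathbb{R}$ is admissible (with constant $L_\gamma>0$) if (1) for every $g\in\mathbb{R}$ the map $z\mapsto\gamma(g,z)$ is Borel measurable on $\mathbb{R}_0$, and for every $z\in\mathbb{R}_0$ the map $g\mapsto\gamma(g,z)$ is continuous; (2) $\int_{\mathbb{R}_0}|\gamma(x,z)-\gamma(y,z)|^2\,\nu(dz)\le L_\gamma^2|x-y|^2$ for all $x,y\in\mathbb{R}$, and $\int_{\mathbb{R}_0}|\gamma(0,z)|^2\,\nu(dz)<\infty$; (3) there is $K_1>0$ with $\sup_{0<|z|\le 1}\frac{|\gamma(g,z)|}{|z|}\le K_1(1+|g|)$ for all $g\in\mathbb{R}$; (4) there is $\epsilon\in(0,1)$ with $\limsup_{|g|\to\infty}\sup_{0<|z|\le1}\frac{|\gamma(g,z)|}{|g|}\le 1-\epsilon$. Operator (for sufficiently smooth $w$): $$\mathcal{L}^{\nu}w=w_t-\rho g\,w_g+\frac{\sigma^2}{2}w_{gg}+\int_{\mathbb{R}_0}\left[w(g+\gamma(g,z),t)-w(g,t)-\gamma(g,z)w_g(g,t)\mathbf{1}_{\{|z|\le1\}}\right]\nu(dz)-rw.$$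 Split test operator: for $\delta\in(0,1)$, $\varphi\in C^{2,1}(\mathbb{R}\times[0,T))$ ($C^2$ in $g$, $C^1$ in $t$) and a function $w$, set $$\mathcal{I}^{1,\delta}[\varphi](g,t):=\int_{0<|z|\le\delta}\left[\varphi(g+\gamma(g,z),t)-\varphi(g,t)-\gamma(g,z)\varphi_g(g,t)\right]\nu(dz),$$ $$\mathcal{I}^{2,\delta}[w,\varphi](g,t):=\int_{|z|>\delta}\left[w(g+\gamma(g,z),t)-w(g,t)-\gamma(g,z)\varphi_g(g,t)\mathbf{1}_{\{|z|\le1\}}\right]\nu(dz),$$ $$\mathcal{L}^{\nu,\delta}[\varphi,w](g,t):=\varphi_t-\rho g\,\varphi_g+\frac{\sigma^2}{2}\varphi_{gg}-r\,w(g,t)+\mathcal{I}^{1,\delta}[\varphi](g,t)+\mathcal{I}^{2,\delta}[w,\varphi](g,t).$$ Viscosity supersolution: a lower semicontinuous $v:\mathbb{R}\times[0,T]\to\mathbb{R}$ with linear growth (there is $C>0$ with $|v(g,t)|\le C(|g|+1)$ on $\mathbb{R}\times[0,T]$) is a viscosity supersolution of the obstacle problem if $v(g,T)\ge 0$ for all $g\in\mathbb{R}$ and, whenever $\varphi\in C^{2,1}(\mathbb{R}\times[0,T))$ is such that $v-\varphi$ attains a global minimum at $(g_0,t_0)\in\mathbb{R}\times[0,T)$ with $v(g_0,t_0)=\varphi(g_0,t_0)$, one has for every $\delta\in(0,1)$ $$\min\left\{-\mathcal{L}^{\nu,\delta}[\varphi,v](g_0,t_0),\ v(g_0,t_0)-v(-g_0,t_0)-\psi(g_0,t_0)\right\}\ge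 0.$$ *)

theory Defs
  imports "HOL-Analysis.Analysis"
begin

text \<open>
  Functions of space and time are functions on \<^typ>\<open>real \<times> real\<close>, written as \<open>w (g, t)\<close>; they are
  total, and only their values on \<open>\<real> \<times> [0,T]\<close> (or \<open>\<real> \<times> [0,T)\<close> for test functions) are ever used.
\<close>

definition time_profile :: "real \<Rightarrow> (real \<Rightarrow> real) \<Rightarrow> bool" where
  "time_profile T \<alpha> \<longleftrightarrow>
     (\<exists>\<alpha>'. continuous_on {0..T} \<alpha>' \<and>
        (\<forall>t\<in>{0..T}. (\<alpha> has_real_derivative \<alpha>' t) (at t within {0..T}) \<and> \<alpha>' t \<le> 0)) \<and>
     (\<forall>t\<in>{0..T}. \<alpha> t \<ge> 0) \<and> (\<exists>t\<in>{0..T}. \<alpha> t \<noteq> 0) \<and> \<alpha> T = 0"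

definition payoff :: "(real \<Rightarrow> real) \<Rightarrow> real \<Rightarrow> real \<Rightarrow> real \<Rightarrow> real" where
  "payoff \<alpha> c g t = g * \<alpha> t - c"

definition levy_measure :: "real measure \<Rightarrow> bool" where
  "levy_measure \<nu> \<longleftrightarrow>
     sets \<nu> = sets (restrict_space borel (- {0})) \<and>
     (\<integral>\<^sup>+ z. ennreal (min 1 (z\<^sup>2)) \<partial>\<nu>) < \<infinity>"

text \<open>
  The suprema are taken in \<^typ>\<open>ereal\<close>, so that an unbounded family has supremum \<open>\<infinity>\<close>;
  \<^const>\<open>at_infinity\<close> on \<^typ>\<open>real\<close> is the filter \<open>\<bar>g\<bar> \<rightarrow> \<infinity>\<close>.
\<close>

definition admissible_jump :: "real measure \<Rightarrow> (real \<Rightarrow> real \<Rightarrow> real) \<Rightarrow> real \<Rightarrow> bool" where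
  "admissible_jump \<nu> \<gamma> L \<longleftrightarrow>
     L > 0 \<and>
     (\<forall>g. \<gamma> g \<in> borel_measurable (restrict_space borel (- {0}))) \<and>
     (\<forall>z. z \<noteq> 0 \<longrightarrow> continuous_on UNIV (\<lambda>g. \<gamma> g z)) \<and>
     (\<forall>x y. (\<integral>\<^sup>+ z. ennreal (\<bar>\<gamma> x z - \<gamma> y z\<bar>\<^sup>2) \<partial>\<nu>) \<le> ennreal (L\<^sup>2 * \<bar>x - y\<bar>\<^sup>2)) \<and>
     (\<integral>\<^sup>+ z. ennreal (\<bar>\<gamma> 0 z\<bar>\<^sup>2) \<partial>\<nu>) < \<infinity> \<and>
     (\<exists>K\<^sub>1>0. \<forall>g. (SUP z\<in>{z. 0 < \<bar>z\<bar> \<and> \<bar>z\<bar> \<le> 1}. ereal (\<bar>\<gamma> g z\<bar> / \<bar>z\<bar>)) \<le> ereal (K\<^sub>1 * (1 + \<bar>g\<bar>))) \<and>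
     (\<exists>\<epsilon>. 0 < \<epsilon> \<and> \<epsilon> < 1 \<and>
        Limsup at_infinity (\<lambda>g. SUP z\<in>{z. 0 < \<bar>z\<bar> \<and> \<bar>z\<bar> \<le> 1}. ereal (\<bar>\<gamma> g z\<bar> / \<bar>g\<bar>)) \<le> ereal (1 - \<epsilon>))"

definition d_g :: "(real \<times> real \<Rightarrow> real) \<Rightarrow> real \<times> real \<Rightarrow> real" where
  "d_g \<phi> = (\<lambda>(g, t). deriv (\<lambda>x. \<phi> (x, t)) g)"

definition d_gg :: "(real \<times> real \<Rightarrow> real) \<Rightarrow> real \<times> real \<Rightarrow> real" where
  "d_gg \<phi> = d_g (d_g \<phi>)"

text \<open>The time derivative is relative to \<open>[0,T)\<close>: it is the right derivative at \<open>t = 0\<close>.\<close>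

definition d_t :: "real \<Rightarrow> (real \<times> real \<Rightarrow> real) \<Rightarrow> real \<times> real \<Rightarrow> real" where
  "d_t T \<phi> = (\<lambda>(g, t). vector_derivative (\<lambda>s. \<phi> (g, s)) (at t within {0..<T}))"

definition C21 :: "real \<Rightarrow> (real \<times> real \<Rightarrow> real) \<Rightarrow> bool" where
  "C21 T \<phi> \<longleftrightarrow>
     (\<forall>g. \<forall>t\<in>{0..<T}.
        (\<lambda>x. \<phi> (x, t)) differentiable (at g) \<and>
        (\<lambda>x. d_g \<phi> (x, t)) differentiable (at g) \<and>
        (\<lambda>s. \<phi> (g, s)) differentiable (at t within {0..<T})) \<and>
     continuous_on (UNIV \<times> {0..<T}) \<phi> \<and>
     continuous_on (UNIV \<times> {0..<T}) (d_g \<phi>) \<and>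
     continuous_on (UNIV \<times> {0..<T}) (d_gg \<phi>) \<and>
     continuous_on (UNIV \<times> {0..<T}) (d_t T \<phi>)"

definition I1 :: "real measure \<Rightarrow> (real \<Rightarrow> real \<Rightarrow> real) \<Rightarrow> real \<Rightarrow>
    (real \<times> real \<Rightarrow> real) \<Rightarrow> real \<Rightarrow> real \<Rightarrow> real" where
  "I1 \<nu> \<gamma> \<delta> \<phi> g t =
     (LINT z:{z. 0 < \<bar>z\<bar> \<and> \<bar>z\<bar> \<le> \<delta>}|\<nu>. \<phi> (g + \<gamma> g z, t) - \<phi> (g, t) - \<gamma> g z * d_g \<phi> (g, t))"

definition I2 :: "real measure \<Rightarrow> (real \<Rightarrow> real \<Rightarrow> real) \<Rightarrow> real \<Rightarrow>
    (real \<times> real \<Rightarrow> real) \<Rightarrow> (real \<times> real \<Rightarrow> real) \<Rightarrow> real \<Rightarrow> real \<Rightarrow> real" where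
  "I2 \<nu> \<gamma> \<delta> w \<phi> g t =
     (LINT z:{z. \<delta> < \<bar>z\<bar>}|\<nu>.
        w (g + \<gamma> g z, t) - w (g, t) - \<gamma> g z * d_g \<phi> (g, t) * indicator {z. \<bar>z\<bar> \<le> 1} z)"

definition split_operator :: "real \<Rightarrow> real \<Rightarrow> real \<Rightarrow> real \<Rightarrow> real measure \<Rightarrow> (real \<Rightarrow> real \<Rightarrow> real) \<Rightarrow>
    real \<Rightarrow> (real \<times> real \<Rightarrow> real) \<Rightarrow> (real \<times> real \<Rightarrow> real) \<Rightarrow> real \<Rightarrow> real \<Rightarrow> real" where
  "split_operator T r \<rho> \<sigma> \<nu> \<gamma> \<delta> \<phi> w g t =
     d_t T \<phi> (g, t) - \<rho> * g * d_g \<phi> (g, t) + \<sigma>\<^sup>2 / 2 * d_gg \<phi> (g, t) - r * w (g, t)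
     + I1 \<nu> \<gamma> \<delta> \<phi> g t + I2 \<nu> \<gamma> \<delta> w \<phi> g t"

definition lower_semicontinuous_on :: "'a::topological_space set \<Rightarrow> ('a \<Rightarrow> real) \<Rightarrow> bool" where
  "lower_semicontinuous_on S f \<longleftrightarrow> (\<forall>x\<in>S. \<forall>a<f x. \<forall>\<^sub>F y in at x within S. a < f y)"

text \<open>
  A test function is given on \<open>\<real> \<times> [0,T)\<close> only, so that is the set over which the minimum of
  \<open>v - \<phi>\<close> is global; the minimum value is 0 by the normalisation at \<open>(g\<^sub>0, t\<^sub>0)\<close>.
\<close>

definition viscosity_supersolution :: "real \<Rightarrow> real \<Rightarrow> real \<Rightarrow> real \<Rightarrow> real \<Rightarrow> (real \<Rightarrow> real) \<Rightarrow>
    real measure \<Rightarrow> (real \<Rightarrow> real \<Rightarrow> real) \<Rightarrow> (real \<times> real \<Rightarrow> real) \<Rightarrow> bool" where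
  "viscosity_supersolution T r \<rho> \<sigma> c \<alpha> \<nu> \<gamma> v \<longleftrightarrow>
     lower_semicontinuous_on (UNIV \<times> {0..T}) v \<and>
     (\<exists>C>0. \<forall>g. \<forall>t\<in>{0..T}. \<bar>v (g, t)\<bar> \<le> C * (\<bar>g\<bar> + 1)) \<and>
     (\<forall>g. v (g, T) \<ge> 0) \<and>
     (\<forall>\<phi> g\<^sub>0 t\<^sub>0. C21 T \<phi> \<longrightarrow> t\<^sub>0 \<in> {0..<T} \<longrightarrow>
        (\<forall>g. \<forall>t\<in>{0..<T}. v (g\<^sub>0, t\<^sub>0) - \<phi> (g\<^sub>0, t\<^sub>0) \<le> v (g, t) - \<phi> (g, t)) \<longrightarrow>
        v (g\<^sub>0, t\<^sub>0) = \<phi> (g\<^sub>0, t\<^sub>0) \<longrightarrow>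
        (\<forall>\<delta>. 0 < \<delta> \<longrightarrow> \<delta> < 1 \<longrightarrow>
           min (- split_operator T r \<rho> \<sigma> \<nu> \<gamma> \<delta> \<phi> v g\<^sub>0 t\<^sub>0)
               (v (g\<^sub>0, t\<^sub>0) - v (- g\<^sub>0, t\<^sub>0) - payoff \<alpha> c g\<^sub>0 t\<^sub>0) \<ge> 0))"

end

theory Submission
  imports Defs
begin

text \<open>
  The obstacle only sees the odd part of \<open>u\<close> in \<open>g\<close>, and the growth of \<open>u\<close> is governed by its
  even part, so the two can be chosen independently. Take
  \<open>u (g, t) = \<alpha> t * g / 2 + E t * \<langle>g\<rangle>\<close> with \<open>\<langle>g\<rangle> = sqrt (1 + g\<^sup>2)\<close> and
  \<open>E t = A * exp (\<kappa> * (T - t))\<close>. Then \<open>u (g, t) - u (- g, t) = g * \<alpha> t\<close>, which exceeds the payoff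
  by exactly \<open>c > 0\<close>, whatever \<open>E\<close> is. If \<open>A\<close> bounds \<open>\<bar>\<alpha>\<bar>\<close> and \<open>\<bar>\<alpha>'\<bar>\<close> on \<open>[0,T]\<close>, the even part also dominates
  the odd one, and \<open>0 \<le> u\<close> grows at most linearly.

  It remains to make the generator nonpositive. Every term of it other than the time derivative of
  \<open>E\<close> is at most a constant times \<open>E t * \<langle>g\<rangle>\<close>, where the constant does not depend on \<open>\<kappa>\<close>, while that
  time derivative contributes \<open>- \<kappa> * E t * \<langle>g\<rangle>\<close>; a large \<open>\<kappa>\<close> therefore wins. The term that calls for
  an argument is the jump integral. The function \<open>\<langle>\<cdot>\<rangle>\<close> is so flat at infinity that its second-order
  remainder at \<open>g\<close> is at most \<open>h\<^sup>2 / (2 * \<langle>g\<rangle>)\<close> for every increment \<open>h\<close>, small or large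
  (\<open>bracket_second_order\<close>). Since the second moment of \<open>\<gamma> g\<close> under \<open>\<nu>\<close> is at most \<open>C * \<langle>g\<rangle>\<^sup>2\<close>
  (\<open>jump_second_moment\<close>), the small jumps contribute at most a multiple of \<open>\<langle>g\<rangle>\<close>. A large jump
  changes \<open>u\<close> by at most a multiple of \<open>\<bar>\<gamma> g z\<bar> \<le> (\<gamma> g z)\<^sup>2 / \<langle>g\<rangle> + \<langle>g\<rangle>\<close>, which is integrable because
  large jumps have finite intensity.

  As \<open>u\<close> is smooth in \<open>g\<close> and differentiable in \<open>t\<close>, a test function touching it from below has the
  same slope, no larger second and time derivatives (\<open>derivatives_at_touching_point\<close>), and no
  larger compensated increment at any jump; so the classical inequality for \<open>u\<close> passes to the
  test function.
\<close>

section \<open>A smooth substitute for the absolute value\<close>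

text \<open>The Japanese bracket \<open>\<langle>x\<rangle>\<close>.\<close>

definition bracket :: "real \<Rightarrow> real" where
  "bracket x = sqrt (1 + x\<^sup>2)"

lemma bracket_square: "(bracket x)\<^sup>2 = 1 + x\<^sup>2"
  by (simp add: bracket_def)

lemma bracket_ge_1: "1 \<le> bracket x"
  by (simp add: bracket_def)

lemma bracket_pos: "0 < bracket x"
  using bracket_ge_1[of x] by linarith

lemma abs_le_bracket: "\<bar>x\<bar> \<le> bracket x"
  unfolding bracket_def by (rule real_le_rsqrt) simp

lemma bracket_le: "bracket x \<le> 1 + \<bar>x\<bar>"
  unfolding bracket_def by (rule real_le_lsqrt) (auto simp: power2_eq_square algebra_simps)

lemma bracket_minus [simp]: "bracket (- x) = bracket x"
  by (simp add: bracket_def)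

text \<open>
  After multiplication by \<open>2 * \<langle>x\<rangle>\<close> this is the inequality of arithmetic and geometric means for
  \<open>\<langle>x\<rangle>\<close> and \<open>\<langle>x + h\<rangle>\<close>. The factor \<open>1 / \<langle>x\<rangle>\<close>, uniform in \<open>h\<close>, is what turns a jump variance of
  order \<open>\<langle>x\<rangle>\<^sup>2\<close> into a contribution of linear growth; the bound \<open>h\<^sup>2 / 2\<close> coming from the supremum of
  the second derivative would leave quadratic growth.
\<close>

lemma bracket_second_order:
  "bracket (x + h) - bracket x - h * (x / bracket x) \<le> h\<^sup>2 / (2 * bracket x)"
proof -
  have "2 * bracket x * bracket (x + h) \<le> (bracket x)\<^sup>2 + (bracket (x + h))\<^sup>2"
    by (rule sum_squares_bound)
  then have "2 * bracket x * bracket (x + h) - 2 * (bracket x)\<^sup>2 - 2 * h * x \<le> h\<^sup>2"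
    unfolding bracket_square by (simp add: power2_eq_square algebra_simps)
  moreover have "2 * bracket x * (bracket (x + h) - bracket x - h * (x / bracket x))
      = 2 * bracket x * bracket (x + h) - 2 * (bracket x)\<^sup>2 - 2 * h * x"
    using bracket_pos[of x] by (simp add: right_diff_distrib power2_eq_square)
  ultimately show ?thesis
    using bracket_pos[of x] by (simp add: pos_le_divide_eq mult.commute)
qed

lemma bracket_first_order: "bracket (x + h) \<le> bracket x + \<bar>h\<bar>"
proof -
  have "x * h \<le> bracket x * \<bar>h\<bar>"
    using mult_right_mono[OF abs_le_bracket[of x], of "\<bar>h\<bar>"] abs_mult[of x h] by linarith
  then have "(bracket (x + h))\<^sup>2 \<le> (bracket x + \<bar>h\<bar>)\<^sup>2"
    by (simp add: bracket_square power2_sum algebra_simps)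
  then show ?thesis
    by (rule power2_le_imp_le) (use bracket_pos[of x] in simp)
qed

lemma bracket_has_derivative:
  "(bracket has_real_derivative x / bracket x) (at x)"
proof -
  have "0 < 1 + x\<^sup>2" by (simp add: add_pos_nonneg)
  then show ?thesis
    unfolding bracket_def
    by (auto intro!: derivative_eq_intros simp: field_simps)
qed

lemma bracket_has_second_derivative:
  "((\<lambda>x. x / bracket x) has_real_derivative 1 / (bracket x) ^ 3) (at x)"
proof -
  have "((\<lambda>x. x / bracket x) has_real_derivative
      (1 * bracket x - x * (x / bracket x)) / (bracket x * bracket x)) (at x)"
    using bracket_pos[of x]
    by (intro DERIV_divide DERIV_ident bracket_has_derivative) simp
  moreover have "(1 * bracket x - x * (x / bracket x)) / (bracket x * bracket x)
      = ((bracket x)\<^sup>2 - x\<^sup>2) / (bracket x) ^ 3"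
    using bracket_pos[of x] by (simp add: field_simps power2_eq_square power3_eq_cube)
  ultimately show ?thesis by (simp add: bracket_square)
qed

lemma continuous_on_bracket [continuous_intros]:
  "continuous_on S f \<Longrightarrow> continuous_on S (\<lambda>x. bracket (f x))"
  unfolding bracket_def by (intro continuous_intros)

section \<open>Test functions touching from below\<close>

text \<open>
  If the derivative \<open>c\<close> of \<open>f'\<close> at \<open>a\<close> were negative, \<open>f'\<close> would be negative just to the right of its zero \<open>a\<close>, and \<open>f\<close>
  would fall below its minimum there.
\<close>

lemma second_derivative_nonneg_at_minimum:
  fixes f :: "real \<Rightarrow> real"
  assumes d1: "\<And>x. (f has_real_derivative f' x) (at x)"
    and d2: "(f' has_real_derivative c) (at a)"
    and min: "\<And>x. f a \<le> f x"
  shows "f' a = 0" and "0 \<le> c"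
proof -
  show z: "f' a = 0"
    using DERIV_local_min[OF d1, of 1 a] min by simp
  show "0 \<le> c"
  proof (rule ccontr)
    assume "\<not> 0 \<le> c"
    then obtain d where d: "d > 0" "\<And>h. 0 < h \<Longrightarrow> h < d \<Longrightarrow> f' (a + h) < 0"
      using DERIV_neg_dec_right[OF d2] z by auto
    obtain y where y: "a < y" "y < a + d / 2" "f (a + d / 2) - f a = (a + d / 2 - a) * f' y"
      using MVT2[of a "a + d / 2" f f'] d1 d(1) by auto
    have "f' y < 0"
      using d(2)[of "y - a"] y d(1) by simp
    then have "f (a + d / 2) < f a"
      using y(3) d(1) mult_pos_neg[of "d / 2" "f' y"] by simp
    then show False using min[of "a + d / 2"] by simp
  qed
qed

text \<open>
  In time only an inequality survives: at \<open>t = 0\<close> the minimum is one-sided. The half-open interval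
  always leaves room to move to the right of \<open>t\<close>, and this is the direction that bounds the time
  derivative of \<open>\<phi>\<close> from above.
\<close>

lemma derivatives_at_touching_point:
  assumes C: "C21 T \<phi>" and t: "t \<in> {0..<T}"
    and min: "\<forall>x. \<forall>s\<in>{0..<T}. v (g, t) - \<phi> (g, t) \<le> v (x, s) - \<phi> (x, s)"
    and vg: "\<And>x. ((\<lambda>x. v (x, t)) has_real_derivative v\<^sub>g x) (at x)"
    and vgg: "(v\<^sub>g has_real_derivative b) (at g)"
    and vt: "((\<lambda>s. v (g, s)) has_real_derivative p) (at t within {0..<T})"
  shows "d_g \<phi> (g, t) = v\<^sub>g g" and "d_gg \<phi> (g, t) \<le> b" and "d_t T \<phi> (g, t) \<le> p"
proof -
  have 1: "((\<lambda>x. \<phi> (x, t)) has_real_derivative d_g \<phi> (x, t)) (at x)" for x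
    using C t unfolding C21_def d_g_def
    by (simp add: DERIV_deriv_iff_real_differentiable)
  have 2: "((\<lambda>x. d_g \<phi> (x, t)) has_real_derivative d_gg \<phi> (g, t)) (at g)"
    using C t unfolding C21_def d_gg_def d_g_def[of "d_g \<phi>"]
    by (simp add: DERIV_deriv_iff_real_differentiable)
  have 3: "((\<lambda>s. \<phi> (g, s)) has_real_derivative d_t T \<phi> (g, t)) (at t within {0..<T})"
    using C t unfolding C21_def d_t_def
    by (simp add: has_real_derivative_iff_has_vector_derivative vector_derivative_works)
  have min_t: "v (g, t) - \<phi> (g, t) \<le> v (x, t) - \<phi> (x, t)" for x
    using min t by blast
  note space = second_derivative_nonneg_at_minimum
      [OF DERIV_diff[OF vg 1] DERIV_diff[OF vgg 2] min_t]
  show "d_g \<phi> (g, t) = v\<^sub>g g" "d_gg \<phi> (g, t) \<le> b"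
    using space by auto
  show "d_t T \<phi> (g, t) \<le> p"
  proof (rule ccontr)
    assume "\<not> ?thesis"
    then obtain d where d: "d > 0"
      "\<And>h. 0 < h \<Longrightarrow> t + h \<in> {0..<T} \<Longrightarrow> h < d \<Longrightarrow>
         v (g, t + h) - \<phi> (g, t + h) < v (g, t) - \<phi> (g, t)"
      using has_real_derivative_neg_dec_right[OF DERIV_diff[OF vt 3]] by auto
    define h where "h = min d (T - t) / 2"
    have h: "0 < h" "h < d" "t + h \<in> {0..<T}"
      using d(1) t by (auto simp: h_def min_def field_simps)
    show False using d(2)[OF h(1,3,2)] min[rule_format, OF h(3), of g] by linarith
  qed
qed

section \<open>The jump integral\<close>

text \<open>
  An integrand that is not integrable has integral \<open>0\<close>. Because the majorant \<open>B\<close> is nonnegative, it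
  bounds the integrals in that case as well, so a one-sided pointwise bound is enough. The majorant is spent twice,
  once for each of the two ranges of jump sizes, which costs the factor \<open>2\<close>.
\<close>

lemma nonlocal_terms_le:
  assumes \<delta>: "0 < \<delta>" "\<delta> < 1"
    and below: "\<And>x. \<phi> (x, t) \<le> v (x, t)" and touch: "v (g, t) = \<phi> (g, t)"
    and B: "integrable \<nu> B" "\<And>z. 0 \<le> B z"
    and small: "\<And>z. \<bar>z\<bar> \<le> 1 \<Longrightarrow> v (g + \<gamma> g z, t) - v (g, t) - \<gamma> g z * d_g \<phi> (g, t) \<le> B z"
    and large: "\<And>z. 1 < \<bar>z\<bar> \<Longrightarrow> v (g + \<gamma> g z, t) - v (g, t) \<le> B z"
  shows "I1 \<nu> \<gamma> \<delta> \<phi> g t + I2 \<nu> \<gamma> \<delta> v \<phi> g t \<le> 2 * (LINT z|\<nu>. B z)"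
proof -
  have "I1 \<nu> \<gamma> \<delta> \<phi> g t \<le> (LINT z|\<nu>. B z)"
    unfolding I1_def set_lebesgue_integral_def
  proof (rule integral_mono'[OF B(1)])
    fix z
    show "indicator {z. 0 < \<bar>z\<bar> \<and> \<bar>z\<bar> \<le> \<delta>} z *\<^sub>R
        (\<phi> (g + \<gamma> g z, t) - \<phi> (g, t) - \<gamma> g z * d_g \<phi> (g, t)) \<le> B z"
      using small[of z] below[of "g + \<gamma> g z"] touch \<delta> B(2)[of z]
      by (auto simp: indicator_def)
  qed (rule B(2))
  moreover have "I2 \<nu> \<gamma> \<delta> v \<phi> g t \<le> (LINT z|\<nu>. B z)"
    unfolding I2_def set_lebesgue_integral_def
  proof (rule integral_mono'[OF B(1)])
    fix z
    show "indicator {z. \<delta> < \<bar>z\<bar>} z *\<^sub>R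
        (v (g + \<gamma> g z, t) - v (g, t) - \<gamma> g z * d_g \<phi> (g, t) * indicator {z. \<bar>z\<bar> \<le> 1} z) \<le> B z"
      using small[of z] large[of z] B(2)[of z]
      by (auto simp: indicator_def)
  qed (rule B(2))
  ultimately show ?thesis by simp
qed

text \<open>
  The Lipschitz condition in \<open>L\<^sup>2(\<nu>)\<close> compares \<open>\<gamma> g\<close> with \<open>\<gamma> 0\<close>, which is square integrable; hence the
  second moment grows at most quadratically in \<open>g\<close>.
\<close>

lemma jump_second_moment:
  assumes "levy_measure \<nu>" and "admissible_jump \<nu> \<gamma> L"
  obtains C where "0 \<le> C"
    and "\<And>g. integrable \<nu> (\<lambda>z. (\<gamma> g z)\<^sup>2)"
    and "\<And>g. (LINT z|\<nu>. (\<gamma> g z)\<^sup>2) \<le> C * (1 + g\<^sup>2)"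
proof -
  have meas: "\<gamma> g \<in> borel_measurable \<nu>" for g
  proof -
    have "sets \<nu> = sets (restrict_space borel (- {0}))"
      using assms(1) by (simp add: levy_measure_def)
    moreover have "\<gamma> g \<in> borel_measurable (restrict_space borel (- {0}))"
      using assms(2) by (simp add: admissible_jump_def)
    ultimately show ?thesis
      by (simp cong: measurable_cong_sets)
  qed
  define D where "D g z = \<gamma> g z - \<gamma> 0 z" for g z
  have D_meas [measurable]: "D g \<in> borel_measurable \<nu>" for g
    unfolding D_def using meas by (intro borel_measurable_diff) auto
  have D_le: "(\<integral>\<^sup>+ z. ennreal ((D g z)\<^sup>2) \<partial>\<nu>) \<le> ennreal (L\<^sup>2 * g\<^sup>2)" for g
  proof -
    have "(\<integral>\<^sup>+ z. ennreal (\<bar>\<gamma> g z - \<gamma> 0 z\<bar>\<^sup>2) \<partial>\<nu>) \<le> ennreal (L\<^sup>2 * \<bar>g - 0\<bar>\<^sup>2)"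
      using assms(2) unfolding admissible_jump_def by blast
    then show ?thesis by (simp add: D_def)
  qed
  have D_int: "integrable \<nu> (\<lambda>z. (D g z)\<^sup>2)" for g
    using le_less_trans[OF D_le[of g] ennreal_less_top] by (intro integrableI_nonneg) auto
  have D_bound: "(LINT z|\<nu>. (D g z)\<^sup>2) \<le> L\<^sup>2 * g\<^sup>2" for g
    using D_le[of g] D_int[of g] by (simp add: nn_integral_eq_integral)
  have 0: "integrable \<nu> (\<lambda>z. (\<gamma> 0 z)\<^sup>2)"
    using assms(2) meas[of 0] unfolding admissible_jump_def
    by (intro integrableI_nonneg) auto
  define G where "G = (LINT z|\<nu>. (\<gamma> 0 z)\<^sup>2)"
  have G: "0 \<le> G" by (simp add: G_def)
  have dom: "(\<gamma> g z)\<^sup>2 \<le> 2 * (D g z)\<^sup>2 + 2 * (\<gamma> 0 z)\<^sup>2" for g z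
    using sum_squares_bound[of "D g z" "\<gamma> 0 z"]
    by (simp add: D_def power2_eq_square algebra_simps)
  have dom_int: "integrable \<nu> (\<lambda>z. 2 * (D g z)\<^sup>2 + 2 * (\<gamma> 0 z)\<^sup>2)" for g
    using D_int 0 by simp
  have int: "integrable \<nu> (\<lambda>z. (\<gamma> g z)\<^sup>2)" for g
    by (rule Bochner_Integration.integrable_bound[OF dom_int[of g]])
      (use meas[of g] dom[of g] in \<open>auto simp: borel_measurable_power\<close>)
  have "(LINT z|\<nu>. (\<gamma> g z)\<^sup>2) \<le> 2 * (L\<^sup>2 + G) * (1 + g\<^sup>2)" for g
  proof -
    have "(LINT z|\<nu>. (\<gamma> g z)\<^sup>2) \<le> (LINT z|\<nu>. 2 * (D g z)\<^sup>2 + 2 * (\<gamma> 0 z)\<^sup>2)"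
      by (rule integral_mono[OF int dom_int dom])
    also have "\<dots> = 2 * (LINT z|\<nu>. (D g z)\<^sup>2) + 2 * G"
      using D_int 0 by (simp add: G_def)
    also have "\<dots> \<le> 2 * (L\<^sup>2 * g\<^sup>2) + 2 * G"
      using D_bound[of g] by simp
    also have "\<dots> \<le> 2 * (L\<^sup>2 + G) * (1 + g\<^sup>2)"
      using G by (simp add: algebra_simps)
    finally show ?thesis .
  qed
  with int G show thesis
    by (intro that[of "2 * (L\<^sup>2 + G)"]) auto
qed

section \<open>The barrier\<close>

definition barrier :: "(real \<Rightarrow> real) \<Rightarrow> (real \<Rightarrow> real) \<Rightarrow> real \<times> real \<Rightarrow> real" where
  "barrier \<alpha> E = (\<lambda>(g, t). \<alpha> t * g / 2 + E t * bracket g)"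

lemma barrier_nonneg:
  assumes "\<bar>\<alpha> t\<bar> \<le> E t"
  shows "0 \<le> barrier \<alpha> E (g, t)"
proof -
  have "\<bar>\<alpha> t * g\<bar> \<le> E t * bracket g"
    using assms abs_le_bracket[of g] by (simp add: abs_mult mult_mono')
  moreover have "0 \<le> E t * bracket g"
    using assms bracket_pos[of g] by simp
  ultimately show ?thesis by (simp add: barrier_def)
qed

lemma barrier_reflection:
  "barrier \<alpha> E (g, t) - barrier \<alpha> E (- g, t) = g * \<alpha> t"
  by (simp add: barrier_def)

text \<open>
  The odd part is linear in \<open>g\<close> and cancels against its compensator. The bound is twice what
  \<open>bracket_second_order\<close> gives, so that it has the same quadratic term as the one for large jumps.
\<close>

lemma barrier_small_jump:
  assumes "0 \<le> E t"
  shows "barrier \<alpha> E (g + h, t) - barrier \<alpha> E (g, t) - h * (\<alpha> t / 2 + E t * (g / bracket g))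
    \<le> E t * (h\<^sup>2 / bracket g)"
proof -
  have "bracket (g + h) - bracket g - h * (g / bracket g) \<le> h\<^sup>2 / (2 * bracket g)"
    by (rule bracket_second_order)
  also have "\<dots> \<le> h\<^sup>2 / bracket g"
    using bracket_pos[of g] by (intro divide_left_mono) auto
  finally have "E t * (bracket (g + h) - bracket g - h * (g / bracket g)) \<le> E t * (h\<^sup>2 / bracket g)"
    by (rule mult_left_mono[OF _ assms])
  then show ?thesis
    by (simp add: barrier_def algebra_simps add_divide_distrib)
qed

text \<open>
  Large jumps are not compensated, so the bound rests on the Lipschitz constant of the barrier in
  \<open>g\<close>, at most \<open>3 * E t / 2\<close>. The resulting \<open>\<bar>h\<bar>\<close> is split into \<open>h\<^sup>2 / \<langle>g\<rangle>\<close> and \<open>\<langle>g\<rangle>\<close> with weights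
  adapted to \<open>g\<close>: it is this choice that keeps the integral over \<open>z\<close> of linear growth in \<open>g\<close>.
\<close>

lemma barrier_large_jump:
  assumes "\<bar>\<alpha> t\<bar> \<le> E t"
  shows "barrier \<alpha> E (g + h, t) - barrier \<alpha> E (g, t) \<le> E t * (h\<^sup>2 / bracket g + bracket g)"
proof -
  have E: "0 \<le> E t" using assms by linarith
  have "\<bar>\<alpha> t * h\<bar> \<le> E t * \<bar>h\<bar>"
    using assms by (simp add: abs_mult mult_right_mono)
  moreover have "E t * (bracket (g + h) - bracket g) \<le> E t * \<bar>h\<bar>"
    using bracket_first_order[of g h] E by (intro mult_left_mono) auto
  moreover have "2 * \<bar>h\<bar> \<le> h\<^sup>2 / bracket g + bracket g"
    using sum_squares_bound[of "\<bar>h\<bar>" "bracket g"] bracket_pos[of g]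
    by (simp add: field_simps power2_eq_square)
  then have "E t * (2 * \<bar>h\<bar>) \<le> E t * (h\<^sup>2 / bracket g + bracket g)"
    by (rule mult_left_mono[OF _ E])
  moreover have "barrier \<alpha> E (g + h, t) - barrier \<alpha> E (g, t)
      = \<alpha> t * h / 2 + E t * (bracket (g + h) - bracket g)"
    by (simp add: barrier_def algebra_simps add_divide_distrib)
  moreover have "0 \<le> E t * \<bar>h\<bar>" using E by simp
  ultimately show ?thesis by linarith
qed

lemma barrier_nonlocal_terms_le:
  assumes \<nu>: "levy_measure \<nu>" "emeasure \<nu> {z. \<bar>z\<bar> > 1} < \<infinity>"
    and moment: "integrable \<nu> (\<lambda>z. (\<gamma> g z)\<^sup>2)" "(LINT z|\<nu>. (\<gamma> g z)\<^sup>2) \<le> C * (1 + g\<^sup>2)"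
    and \<delta>: "0 < \<delta>" "\<delta> < 1"
    and E: "\<bar>\<alpha> t\<bar> \<le> E t"
    and below: "\<And>x. \<phi> (x, t) \<le> barrier \<alpha> E (x, t)"
    and touch: "barrier \<alpha> E (g, t) = \<phi> (g, t)"
    and slope: "d_g \<phi> (g, t) = \<alpha> t / 2 + E t * (g / bracket g)"
  shows "I1 \<nu> \<gamma> \<delta> \<phi> g t + I2 \<nu> \<gamma> \<delta> (barrier \<alpha> E) \<phi> g t
    \<le> 2 * (C + measure \<nu> {z. \<bar>z\<bar> > 1}) * (E t * bracket g)"
proof -
  let ?S = "{z::real. 1 < \<bar>z\<bar>}"
  define B where "B z = E t * ((\<gamma> g z)\<^sup>2 / bracket g + bracket g * indicator ?S z)" for z
  have E0: "0 \<le> E t" using E by linarith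
  have "?S \<in> sets borel" by measurable
  then have S: "?S \<in> sets \<nu>"
    using \<nu>(1) unfolding levy_measure_def
    by (auto simp: sets_restrict_space_iff)
  have ind: "integrable \<nu> (indicator ?S :: real \<Rightarrow> real)"
    using S \<nu>(2) by simp
  have B_int: "integrable \<nu> B"
    unfolding B_def using moment(1) ind by simp
  have B0: "0 \<le> B z" for z
    using E0 bracket_pos[of g] by (simp add: B_def)
  have "I1 \<nu> \<gamma> \<delta> \<phi> g t + I2 \<nu> \<gamma> \<delta> (barrier \<alpha> E) \<phi> g t \<le> 2 * (LINT z|\<nu>. B z)"
  proof (rule nonlocal_terms_le[where \<phi> = \<phi>, OF \<delta> below touch B_int B0])
    fix z :: real
    assume "\<bar>z\<bar> \<le> 1"
    then show "barrier \<alpha> E (g + \<gamma> g z, t) - barrier \<alpha> E (g, t) - \<gamma> g z * d_g \<phi> (g, t) \<le> B z"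
      using barrier_small_jump[of E t, OF E0, of \<alpha> g "\<gamma> g z"] slope by (simp add: B_def)
  next
    fix z :: real
    assume "1 < \<bar>z\<bar>"
    then show "barrier \<alpha> E (g + \<gamma> g z, t) - barrier \<alpha> E (g, t) \<le> B z"
      using barrier_large_jump[of \<alpha> t E, OF E, of g "\<gamma> g z"] by (simp add: B_def)
  qed
  also have "(LINT z|\<nu>. B z)
      = E t * ((LINT z|\<nu>. (\<gamma> g z)\<^sup>2) / bracket g + bracket g * measure \<nu> ?S)"
    unfolding B_def using moment(1) ind S by simp
  also have "\<dots> \<le> E t * (C * bracket g + bracket g * measure \<nu> ?S)"
  proof (intro mult_left_mono[OF _ E0] add_right_mono)
    show "(LINT z|\<nu>. (\<gamma> g z)\<^sup>2) / bracket g \<le> C * bracket g"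
      using moment(2) bracket_pos[of g] unfolding bracket_square[symmetric]
      by (simp add: pos_divide_le_eq power2_eq_square mult.assoc)
  qed
  finally show ?thesis by (simp add: algebra_simps)
qed

text \<open>
  All terms are measured in units of \<open>X = E t * \<langle>g\<rangle>\<close>. The summands of \<open>\<kappa>\<close> pay, in this order, for
  the time derivative of \<open>\<alpha>\<close>, the drift, the diffusion and the jumps, so that the total is \<open>0\<close>; the
  discount term has the right sign because the barrier is nonnegative.
\<close>

lemma barrier_supersolution_inequality:
  assumes pos: "0 < r" "0 \<le> \<rho>"
    and \<nu>: "levy_measure \<nu>" "emeasure \<nu> {z. \<bar>z\<bar> > 1} < \<infinity>"
    and moment: "\<And>g. integrable \<nu> (\<lambda>z. (\<gamma> g z)\<^sup>2)"
      "\<And>g. (LINT z|\<nu>. (\<gamma> g z)\<^sup>2) \<le> C * (1 + g\<^sup>2)"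
    and \<kappa>: "\<kappa> = 1 + \<rho> + \<sigma>\<^sup>2 / 2 + 2 * (C + measure \<nu> {z. \<bar>z\<bar> > 1})"
    and t: "t \<in> {0..<T}"
    and \<alpha>: "(\<alpha> has_real_derivative \<alpha>') (at t within {0..<T})" "\<bar>\<alpha>'\<bar> \<le> E t" "\<bar>\<alpha> t\<bar> \<le> E t"
    and E: "(E has_real_derivative - \<kappa> * E t) (at t)"
    and C: "C21 T \<phi>"
    and min: "\<forall>x. \<forall>s\<in>{0..<T}.
      barrier \<alpha> E (g, t) - \<phi> (g, t) \<le> barrier \<alpha> E (x, s) - \<phi> (x, s)"
    and touch: "barrier \<alpha> E (g, t) = \<phi> (g, t)"
    and \<delta>: "0 < \<delta>" "\<delta> < 1"
  shows "split_operator T r \<rho> \<sigma> \<nu> \<gamma> \<delta> \<phi> (barrier \<alpha> E) g t \<le> 0"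
proof -
  define X where "X = E t * bracket g"
  have E0: "0 \<le> E t" using \<alpha>(3) by linarith
  have g: "\<bar>y * g\<bar> \<le> X" if "\<bar>y\<bar> \<le> E t" for y
    unfolding X_def abs_mult using that abs_le_bracket[of g] by (intro mult_mono') auto
  have deriv_g: "((\<lambda>x. barrier \<alpha> E (x, t)) has_real_derivative
      \<alpha> t / 2 + E t * (x / bracket x)) (at x)" for x
    unfolding barrier_def
    by (auto intro!: derivative_eq_intros bracket_has_derivative)
  have deriv_gg: "((\<lambda>x. \<alpha> t / 2 + E t * (x / bracket x)) has_real_derivative
      0 + E t * (1 / (bracket g) ^ 3)) (at g)"
    by (intro DERIV_add DERIV_const DERIV_cmult bracket_has_second_derivative)
  have deriv_t: "((\<lambda>s. barrier \<alpha> E (g, s)) has_real_derivative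
      \<alpha>' * g / 2 - \<kappa> * X) (at t within {0..<T})"
    unfolding barrier_def X_def
    by (auto intro!: derivative_eq_intros \<alpha>(1) has_field_derivative_at_within[OF E])
  note D = derivatives_at_touching_point[OF C t min deriv_g deriv_gg deriv_t]

  have below: "\<phi> (x, t) \<le> barrier \<alpha> E (x, t)" for x
    using min t touch by force
  have nonlocal: "I1 \<nu> \<gamma> \<delta> \<phi> g t + I2 \<nu> \<gamma> \<delta> (barrier \<alpha> E) \<phi> g t
      \<le> 2 * (C + measure \<nu> {z. \<bar>z\<bar> > 1}) * X"
    unfolding X_def
    by (rule barrier_nonlocal_terms_le[where \<phi> = \<phi> and \<gamma> = \<gamma> and \<alpha> = \<alpha> and E = E,
          OF \<nu> moment(1,2) \<delta> \<alpha>(3) below touch D(1)])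
  have "0 \<le> X" using E0 bracket_pos[of g] by (simp add: X_def)
  have time: "d_t T \<phi> (g, t) \<le> X - \<kappa> * X"
    using D(3) g[OF \<alpha>(2)] \<open>0 \<le> X\<close> by linarith
  have drift: "- \<rho> * g * d_g \<phi> (g, t) \<le> \<rho> * X"
  proof -
    have "- g * d_g \<phi> (g, t) = - (\<alpha> t * g) / 2 - E t * (g\<^sup>2 / bracket g)"
      unfolding D(1) by (simp add: algebra_simps power2_eq_square)
    also have "\<dots> \<le> X"
    proof -
      have "0 \<le> E t * (g\<^sup>2 / bracket g)"
        using E0 bracket_pos[of g] by simp
      then show ?thesis
        using g[OF \<alpha>(3)] \<open>0 \<le> X\<close> by linarith
    qed
    finally have "\<rho> * (- g * d_g \<phi> (g, t)) \<le> \<rho> * X"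
      by (rule mult_left_mono[OF _ pos(2)])
    then show ?thesis by simp
  qed
  have diffusion: "\<sigma>\<^sup>2 / 2 * d_gg \<phi> (g, t) \<le> \<sigma>\<^sup>2 / 2 * X"
  proof (rule mult_left_mono)
    have "1 / (bracket g) ^ 3 \<le> 1"
      using bracket_ge_1[of g] by (simp add: one_le_power)
    also note bracket_ge_1[of g]
    finally have "E t * (1 / (bracket g) ^ 3) \<le> X"
      unfolding X_def by (rule mult_left_mono[OF _ E0])
    with D(2) show "d_gg \<phi> (g, t) \<le> X" by simp
  qed simp
  have discount: "0 \<le> r * barrier \<alpha> E (g, t)"
    using barrier_nonneg[of \<alpha> t E g, OF \<alpha>(3)] pos(1) by simp
  have "split_operator T r \<rho> \<sigma> \<nu> \<gamma> \<delta> \<phi> (barrier \<alpha> E) g t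
      \<le> X - \<kappa> * X + \<rho> * X + \<sigma>\<^sup>2 / 2 * X + 2 * (C + measure \<nu> {z. \<bar>z\<bar> > 1}) * X"
    unfolding split_operator_def
    using time drift diffusion discount nonlocal by linarith
  also have "\<dots> = 0" unfolding \<kappa> by (simp add: algebra_simps)
  finally show ?thesis .
qed

section \<open>Choice of the constants\<close>

lemma time_profile_bound:
  assumes "time_profile T \<alpha>"
  obtains \<alpha>' A where "0 < A"
    and "\<And>t. t \<in> {0..T} \<Longrightarrow> (\<alpha> has_real_derivative \<alpha>' t) (at t within {0..T})"
    and "\<And>t. t \<in> {0..T} \<Longrightarrow> \<bar>\<alpha> t\<bar> \<le> A"
    and "\<And>t. t \<in> {0..T} \<Longrightarrow> \<bar>\<alpha>' t\<bar> \<le> A"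
proof -
  obtain \<alpha>' where \<alpha>': "continuous_on {0..T} \<alpha>'"
    "\<And>t. t \<in> {0..T} \<Longrightarrow> (\<alpha> has_real_derivative \<alpha>' t) (at t within {0..T})"
    using assms unfolding time_profile_def by blast
  have "continuous_on {0..T} \<alpha>"
    using \<alpha>'(2) by (rule DERIV_continuous_on)
  then have "bounded (\<alpha> ` {0..T})" "bounded (\<alpha>' ` {0..T})"
    using \<alpha>'(1) by (auto intro!: compact_imp_bounded compact_continuous_image)
  then obtain a b where "0 < a" "\<forall>x\<in>\<alpha> ` {0..T}. norm x \<le> a" "\<forall>x\<in>\<alpha>' ` {0..T}. norm x \<le> b"
    by (meson bounded_pos)
  then have "\<bar>\<alpha> t\<bar> \<le> max a b" "\<bar>\<alpha>' t\<bar> \<le> max a b" if "t \<in> {0..T}" for t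
    using that by (simp_all add: le_max_iff_disj less_max_iff_disj)
  with \<open>0 < a\<close> \<alpha>'(2) show thesis
    by (intro that[of "max a b" \<alpha>']) (simp_all add: less_max_iff_disj)
qed

lemma continuous_on_imp_lower_semicontinuous_on:
  "continuous_on S f \<Longrightarrow> lower_semicontinuous_on S f"
  unfolding lower_semicontinuous_on_def continuous_on_def
  by (blast dest: order_tendstoD(1))

theorem theorem3p8:
  fixes T r \<rho> \<sigma> c lam L\<^sub>\<gamma> \<Delta> R\<^sub>0 :: real
    and \<alpha> :: "real \<Rightarrow> real"
    and \<nu> :: "real measure"
    and \<gamma> :: "real \<Rightarrow> real \<Rightarrow> real"
  assumes "T > 0" and "r > 0" and "\<rho> \<ge> 0" and "\<sigma> > 0" and "c > 0"
    and "time_profile T \<alpha>"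
    and "levy_measure \<nu>"
    and "emeasure \<nu> {z. \<bar>z\<bar> > 1} < \<infinity>"
    and "lam = measure \<nu> {z. \<bar>z\<bar> > 1}"
    and "admissible_jump \<nu> \<gamma> L\<^sub>\<gamma>"
    and "r + \<rho> = sqrt lam * L\<^sub>\<gamma>"
    and "0 < \<Delta>" and "\<Delta> < 1" and "R\<^sub>0 > 0"
    and "\<forall>g \<le> - R\<^sub>0. AE z in \<nu>. \<bar>z\<bar> > 1 \<longrightarrow> g + \<gamma> g z \<le> - \<Delta> * \<bar>g\<bar>"
  shows "\<exists>u :: real \<times> real \<Rightarrow> real.
           continuous_on (UNIV \<times> {0..T}) u \<and>
           viscosity_supersolution T r \<rho> \<sigma> c \<alpha> \<nu> \<gamma> u \<and>
           (\<exists>C>0. \<forall>g. \<forall>t\<in>{0..T}. 0 \<le> u (g, t) \<and> u (g, t) \<le> C * (1 + \<bar>g\<bar>))"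
proof -
  obtain \<alpha>' A where A: "0 < A"
    and \<alpha>_deriv: "\<And>t. t \<in> {0..T} \<Longrightarrow> (\<alpha> has_real_derivative \<alpha>' t) (at t within {0..T})"
    and \<alpha>_le: "\<And>t. t \<in> {0..T} \<Longrightarrow> \<bar>\<alpha> t\<bar> \<le> A"
    and \<alpha>'_le: "\<And>t. t \<in> {0..T} \<Longrightarrow> \<bar>\<alpha>' t\<bar> \<le> A"
    using time_profile_bound[OF \<open>time_profile T \<alpha>\<close>] by metis
  obtain C where C: "0 \<le> C"
    and moment: "\<And>g. integrable \<nu> (\<lambda>z. (\<gamma> g z)\<^sup>2)"
      "\<And>g. (LINT z|\<nu>. (\<gamma> g z)\<^sup>2) \<le> C * (1 + g\<^sup>2)"
    using jump_second_moment[OF \<open>levy_measure \<nu>\<close> \<open>admissible_jump \<nu> \<gamma> L\<^sub>\<gamma>\<close>] by metis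
  define \<kappa> where "\<kappa> = 1 + \<rho> + \<sigma>\<^sup>2 / 2 + 2 * (C + measure \<nu> {z. \<bar>z\<bar> > 1})"
  define E where "E t = A * exp (\<kappa> * (T - t))" for t
  define u where "u = barrier \<alpha> E"
  have \<kappa>: "0 \<le> \<kappa>" using C \<open>\<rho> \<ge> 0\<close> by (simp add: \<kappa>_def)
  have A_le_E: "A \<le> E t" if "t \<in> {0..T}" for t
    using that \<kappa> A by (simp add: E_def)
  have E_le: "E t \<le> E 0" if "t \<in> {0..T}" for t
    using that \<kappa> A by (simp add: E_def mult_left_mono)
  have E_deriv: "(E has_real_derivative - \<kappa> * E t) (at t)" for t
    unfolding E_def by (auto intro!: derivative_eq_intros)
  have \<alpha>_le_E: "\<bar>\<alpha> t\<bar> \<le> E t" and \<alpha>'_le_E: "\<bar>\<alpha>' t\<bar> \<le> E t" if "t \<in> {0..T}" for t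
    using \<alpha>_le[OF that] \<alpha>'_le[OF that] A_le_E[OF that] by simp_all

  have \<alpha>_cont: "continuous_on {0..T} \<alpha>"
    using \<alpha>_deriv by (rule DERIV_continuous_on)
  have cont: "continuous_on (UNIV \<times> {0..T}) u"
    unfolding u_def barrier_def E_def case_prod_beta
    by (intro continuous_intros continuous_on_compose2[OF \<alpha>_cont]) auto
  have nonneg: "0 \<le> u (g, t)" if "t \<in> {0..T}" for g t
    unfolding u_def using \<alpha>_le_E[OF that] by (rule barrier_nonneg)
  \<comment> \<open>\<open>E\<close> is decreasing, so its value at time \<open>0\<close> bounds it.\<close>
  have growth: "u (g, t) \<le> 2 * E 0 * (1 + \<bar>g\<bar>)" if t: "t \<in> {0..T}" for g t
  proof -
    have E0: "0 \<le> E 0" using A by (simp add: E_def)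
    have "\<bar>\<alpha> t * g\<bar> \<le> E 0 * (1 + \<bar>g\<bar>)"
      unfolding abs_mult using \<alpha>_le_E[OF t] E_le[OF t] by (intro mult_mono') auto
    moreover have "E t * bracket g \<le> E 0 * (1 + \<bar>g\<bar>)"
      using E_le[OF t] E0 bracket_le[of g] bracket_pos[of g] by (intro mult_mono) auto
    moreover have "0 \<le> E 0 * (1 + \<bar>g\<bar>)" using E0 by simp
    moreover have "u (g, t) = \<alpha> t * g / 2 + E t * bracket g"
      by (simp add: u_def barrier_def)
    ultimately show ?thesis by linarith
  qed
  have C_pos: "0 < 2 * E 0" using A by (simp add: E_def)

  have "viscosity_supersolution T r \<rho> \<sigma> c \<alpha> \<nu> \<gamma> u"
    unfolding viscosity_supersolution_def
  proof (intro conjI allI impI)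
    show "lower_semicontinuous_on (UNIV \<times> {0..T}) u"
      using cont by (rule continuous_on_imp_lower_semicontinuous_on)
    show "\<exists>C>0. \<forall>g. \<forall>t\<in>{0..T}. \<bar>u (g, t)\<bar> \<le> C * (\<bar>g\<bar> + 1)"
      using C_pos nonneg growth by (intro exI[of _ "2 * E 0"]) (auto simp: add.commute)
    show "0 \<le> u (g, T)" for g
      using nonneg \<open>T > 0\<close> by simp
  next
    fix \<phi> g t \<delta>
    assume \<phi>: "C21 T \<phi>" and t: "t \<in> {0..<T}"
      and min: "\<forall>x. \<forall>s\<in>{0..<T}. u (g, t) - \<phi> (g, t) \<le> u (x, s) - \<phi> (x, s)"
      and touch: "u (g, t) = \<phi> (g, t)" and \<delta>: "0 < \<delta>" "\<delta> < (1::real)"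
    have t': "t \<in> {0..T}" using t by simp
    have "(\<alpha> has_real_derivative \<alpha>' t) (at t within {0..<T})"
      using \<alpha>_deriv[OF t'] by (rule DERIV_subset) auto
    then have "split_operator T r \<rho> \<sigma> \<nu> \<gamma> \<delta> \<phi> u g t \<le> 0"
      unfolding u_def
      by (rule barrier_supersolution_inequality[where \<gamma> = \<gamma> and \<alpha> = \<alpha> and E = E and t = t and \<phi> = \<phi>,
            OF \<open>r > 0\<close> \<open>\<rho> \<ge> 0\<close> \<open>levy_measure \<nu>\<close>
            \<open>emeasure \<nu> {z. \<bar>z\<bar> > 1} < \<infinity>\<close> moment \<kappa>_def t _ \<alpha>'_le_E[OF t'] \<alpha>_le_E[OF t'] E_deriv \<phi>])
        (use min touch \<delta> in \<open>auto simp: u_def\<close>)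
    moreover have "u (g, t) - u (- g, t) - payoff \<alpha> c g t = c"
      unfolding u_def barrier_reflection payoff_def by simp
    ultimately show "0 \<le> min (- split_operator T r \<rho> \<sigma> \<nu> \<gamma> \<delta> \<phi> u g t)
        (u (g, t) - u (- g, t) - payoff \<alpha> c g t)"
      using \<open>c > 0\<close> by simp
  qed
  moreover have "\<exists>C>0. \<forall>g. \<forall>t\<in>{0..T}. 0 \<le> u (g, t) \<and> u (g, t) \<le> C * (1 + \<bar>g\<bar>)"
    using nonneg growth C_pos by (intro exI[of _ "2 * E 0"]) simp
  ultimately show ?thesis
    using cont by (intro exI[of _ u] conjI)
qed

end
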